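(* (Converse duality) Let $K\subseteq\mathbb{R}^k$ be a nontrivial pointed closed convex cone, let $L\in\mathbb{R}^{k\times n}$, $A\in\mathbb{R}^{m\times n}$, $b\in\mathbb{R}^m$, let $\mathcal{A}=\{x\in\mathbb{R}^n_+ : Ax=b\}$ and $$\mathcal{B}=\{(\lambda,U,v)\in K^{*0}\times\mathbb{R}^{k\times m}\times\mathbb{R}^k : \lambda^Tv=0 \text{ and } (L-UA)^T\lambda\in\mathbb{R}^n_+\}.$$ Let $(P)$ be the problem of vector-minimizing $Lx$ over $x\in\mathcal{A}$, and $(D)$ the problem of vector-maximizing $h(\lambda,U,v)=Ub+v$ over $(\lambda,U,v)\in\mathcal{B}$, both with respect to the partial ordering induced by $K$. If $(\bar\lambda,\bar U,\bar v)\in\mathcal{B}$ is an efficient solution to $(D)$, then there exists $\bar x\in\mathcal{A}$, an efficient solution to $(P)$, such that $L\bar x=\bar Ub+\bar v$.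
   Context: $\mathbb{R}^n_+$ denotes the nonnegative orthant. A set $K\subseteq\mathbb{R}^k$ is a cone if $\lambda K\subseteq K$ for all $\lambda\geq 0$; it is nontrivial if $K\neq\{0\}$ and $K\neq\mathbb{R}^k$, and pointed if $K\cap(-K)=\{0\}$. Write $v\leqq_K w$ if $w-v\in K$, and $v\leq_K w$ if $v\leqq_K w$ and $v\neq w$. Set $K^{*0}=\{\lambda\in\mathbb{R}^k:\lambda^Tv>0\ \forall v\in K\setminus\{0\}\}$. An element $\bar x\in\mathcal{A}$ is an efficient solution to $(P)$ if there is no $x\in\mathcal{A}$ with $Lx\leq_K L\bar x$. An element $(\bar\lambda,\bar U,\bar v)\in\mathcal{B}$ is an efficient solution to $(D)$ if there is no $(\lambda,U,v)\in\mathcal{B}$ with $\bar Ub+\bar v\leq_K Ub+v$. *)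

theory Defs
  imports "HOL-Analysis.Analysis"
begin

definition nontrivial_cone :: "'a::real_vector set \<Rightarrow> bool" where
  "nontrivial_cone K \<longleftrightarrow> cone K \<and> K \<noteq> {0} \<and> K \<noteq> UNIV"

definition pointed_cone :: "'a::real_vector set \<Rightarrow> bool" where
  "pointed_cone K \<longleftrightarrow> cone K \<and> K \<inter> uminus ` K = {0}"

definition cone_leqq :: "'a::real_vector set \<Rightarrow> 'a \<Rightarrow> 'a \<Rightarrow> bool" where
  "cone_leqq K v w \<longleftrightarrow> w - v \<in> K"

definition cone_leq :: "'a::real_vector set \<Rightarrow> 'a \<Rightarrow> 'a \<Rightarrow> bool" where
  "cone_leq K v w \<longleftrightarrow> cone_leqq K v w \<and> v \<noteq> w"

text \<open>The set ^{*0}$; for a closed convex cone it is the quasi-interior of the dual cone,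
  whence the name.\<close>

definition dual_cone_qi :: "'a::real_inner set \<Rightarrow> 'a set" where
  "dual_cone_qi K = {l. \<forall>v \<in> K - {0}. l \<bullet> v > 0}"

definition nonneg_orthant :: "(real ^ 'n) set" where
  "nonneg_orthant = {x. \<forall>i. 0 \<le> x $ i}"

definition efficient_min :: "'b::real_vector set \<Rightarrow> ('a \<Rightarrow> 'b) \<Rightarrow> 'a set \<Rightarrow> 'a \<Rightarrow> bool" where
  "efficient_min K f S x \<longleftrightarrow> x \<in> S \<and> \<not> (\<exists>y\<in>S. cone_leq K (f y) (f x))"

definition efficient_max :: "'b::real_vector set \<Rightarrow> ('a \<Rightarrow> 'b) \<Rightarrow> 'a set \<Rightarrow> 'a \<Rightarrow> bool" where
  "efficient_max K f S x \<longleftrightarrow> x \<in> S \<and> \<not> (\<exists>y\<in>S. cone_leq K (f x) (f y))"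

definition primal_feasible :: "real ^ 'n ^ 'm \<Rightarrow> real ^ 'm \<Rightarrow> (real ^ 'n) set" where
  "primal_feasible A b = {x \<in> nonneg_orthant. A *v x = b}"

definition primal_objective :: "real ^ 'n ^ 'k \<Rightarrow> real ^ 'n \<Rightarrow> real ^ 'k" where
  "primal_objective L x = L *v x"

definition dual_feasible ::
  "(real ^ 'k) set \<Rightarrow> real ^ 'n ^ 'k \<Rightarrow> real ^ 'n ^ 'm \<Rightarrow>
    ((real ^ 'k) \<times> (real ^ 'm ^ 'k) \<times> (real ^ 'k)) set" where
  "dual_feasible K L A =
    {(l, U, v). l \<in> dual_cone_qi K \<and> l \<bullet> v = 0 \<and>
       transpose (L - U ** A) *v l \<in> nonneg_orthant}"

definition dual_objective ::
  "real ^ 'm \<Rightarrow> (real ^ 'k) \<times> (real ^ 'm ^ 'k) \<times> (real ^ 'k) \<Rightarrow> real ^ 'k" where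
  "dual_objective b = (\<lambda>(l, U, v). U *v b + v)"

end

theory Submission
  imports Defs
begin

text \<open>Let \<open>d\<close> be the dual optimal value, attained at \<open>l\<close>, and \<open>y = U\<^sup>T l\<close>. The dual constraint says
  that \<open>y \<bullet> (A x) \<le> l \<bullet> (L x)\<close> for all \<open>x \<ge> 0\<close>, and \<open>l \<bullet> d = y \<bullet> b\<close>. Any other pair \<open>(l', y')\<close>
  with \<open>l' \<in> K\<^sup>*\<^sup>0\<close> satisfying the constraint has \<open>y' \<bullet> b \<le> l' \<bullet> d\<close>, since otherwise moving \<open>d\<close>
  along a direction of \<open>K\<close> would produce a better dual value. If no \<open>x \<ge> 0\<close> solves
  \<open>A x = b\<close>, \<open>L x = d\<close>, Farkas' lemma yields \<open>(q, p)\<close> satisfying the constraint with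
  \<open>p \<bullet> b > q \<bullet> d\<close>. Since \<open>K\<^sup>*\<^sup>0\<close> is open, \<open>(l + e q, y + e p)\<close> for small \<open>e > 0\<close> is then a
  forbidden pair. Efficiency of the solution \<open>x\<close> is weak duality.\<close>

text \<open>Strict separation of \<open>z\<close> from \<open>S\<close> gives a level
  \<open>c\<close>, negative because \<open>0 \<in> S\<close>. Scaling within the cone then excludes
  negative values on \<open>S\<close>.\<close>

lemma separating_hyperplane_closed_cone:
  fixes S :: "'a::euclidean_space set"
  assumes "cone S" "convex S" "closed S" "S \<noteq> {}" "z \<notin> S"
  obtains a where "a \<bullet> z < 0" "\<And>x. x \<in> S \<Longrightarrow> 0 \<le> a \<bullet> x"
proof -
  obtain a c where az: "a \<bullet> z < c" and ac: "\<And>x. x \<in> S \<Longrightarrow> c < a \<bullet> x"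
    using separating_hyperplane_closed_point[OF assms(2,3,5)] by blast
  have "0 \<in> S"
    using assms(1,4) cone_0 cone_contains_0 by blast
  then have c0: "c < 0"
    using ac by fastforce
  show thesis
  proof
    show "a \<bullet> z < 0"
      using az c0 by simp
    show "0 \<le> a \<bullet> x" if x: "x \<in> S" for x
    proof (rule ccontr)
      assume neg: "\<not> 0 \<le> a \<bullet> x"
      \<comment> \<open>The factor is a quotient of two negatives, and the scaled point has value
        exactly \<open>c\<close>, against the strict bound \<open>ac\<close>.\<close>
      have "(c / (a \<bullet> x)) *\<^sub>R x \<in> S"
        using assms(1) x c0 neg by (simp add: cone_def divide_nonpos_neg)
      from ac[OF this] neg show False
        by simp
    qed
  qed
qed

lemma axis_mem_nonneg_orthant: "axis i 1 \<in> nonneg_orthant"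
  by (simp add: nonneg_orthant_def axis_def)

lemma zero_mem_nonneg_orthant: "0 \<in> nonneg_orthant"
  by (simp add: nonneg_orthant_def)

lemma convex_cone_nonneg_orthant: "convex_cone nonneg_orthant"
proof -
  have "nonneg_orthant \<noteq> {}"
    using zero_mem_nonneg_orthant by blast
  then show ?thesis
    by (simp add: convex_cone_def convex_def conic_def nonneg_orthant_def)
qed

text \<open>Finite generation passes to linear images and makes them closed, which
  \<open>farkas\<close> needs for separation.\<close>

lemma nonneg_orthant_eq_convex_cone_hull:
  "(nonneg_orthant :: (real^'n) set) = convex_cone hull (range (\<lambda>i. axis i 1))"
proof
  show "convex_cone hull (range (\<lambda>i. axis i 1)) \<subseteq> (nonneg_orthant :: (real^'n) set)"
    using axis_mem_nonneg_orthant convex_cone_nonneg_orthant by (intro hull_minimal) auto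
  show "(nonneg_orthant :: (real^'n) set) \<subseteq> convex_cone hull (range (\<lambda>i. axis i 1))"
  proof
    fix x :: "real^'n"
    assume x: "x \<in> nonneg_orthant"
    have "(\<Sum>i\<in>I. x $ i *\<^sub>R axis i 1) \<in> convex_cone hull (range (\<lambda>i. axis i 1 :: real^'n))"
      if "finite I" for I
      using that
    proof (induction I)
      case empty
      then show ?case by (simp add: convex_cone_hull_contains_0)
    next
      case (insert i I)
      have "x $ i *\<^sub>R axis i 1 \<in> convex_cone hull (range (\<lambda>i. axis i 1 :: real^'n))"
        using x by (intro convex_cone_hull_mul hull_inc) (auto simp: nonneg_orthant_def)
      with insert show ?case by (simp add: convex_cone_hull_add)
    qed
    from this[of UNIV] show "x \<in> convex_cone hull (range (\<lambda>i. axis i 1))"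
      using basis_expansion[of x] by (simp add: scalar_mult_eq_scaleR)
  qed
qed

lemma farkas:
  fixes f :: "real^'n \<Rightarrow> 'a::euclidean_space"
  assumes "linear f" "z \<notin> f ` nonneg_orthant"
  obtains a where "a \<bullet> z < 0" "\<And>x. x \<in> nonneg_orthant \<Longrightarrow> 0 \<le> a \<bullet> f x"
proof -
  have eq: "f ` nonneg_orthant = convex_cone hull (f ` range (\<lambda>i. axis i 1))"
    unfolding nonneg_orthant_eq_convex_cone_hull
    by (rule convex_cone_hull_linear_image[OF assms(1), symmetric])
  have "cone (f ` nonneg_orthant)"
    unfolding eq by (simp add: cone_def convex_cone_hull_mul)
  moreover have "convex (f ` nonneg_orthant)"
    unfolding eq by (rule convex_convex_cone_hull)
  moreover have "closed (f ` nonneg_orthant)"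
    unfolding eq by (rule closed_convex_cone_hull) simp
  moreover have "f ` nonneg_orthant \<noteq> {}"
    using axis_mem_nonneg_orthant by blast
  ultimately obtain a where "a \<bullet> z < 0" "\<And>y. y \<in> f ` nonneg_orthant \<Longrightarrow> 0 \<le> a \<bullet> y"
    using separating_hyperplane_closed_cone[OF _ _ _ _ assms(2)] by metis
  then show thesis
    by (intro that) auto
qed

text \<open>By compactness \<open>l\<close> has a positive minimum \<open>m\<close> on the unit
  vectors of \<open>K\<close>. A perturbation that changes values there by less than
  \<open>m\<close> keeps them positive, and homogeneity extends this to all of
  \<open>K - {0}\<close>.\<close>

lemma dual_cone_qi_perturb:
  fixes K :: "'a::euclidean_space set"
  assumes "cone K" "closed K" "l \<in> dual_cone_qi K"
  obtains e where "e > 0" "l + e *\<^sub>R q \<in> dual_cone_qi K"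
proof (cases "K \<inter> sphere 0 1 = {}")
  case True
  have "K - {0} = {}"
  proof (rule ccontr)
    assume "K - {0} \<noteq> {}"
    then obtain v where "v \<in> K" "v \<noteq> 0" by blast
    then have "(1 / norm v) *\<^sub>R v \<in> K \<inter> sphere 0 1"
      using assms(1) by (simp add: cone_def)
    with True show False by blast
  qed
  with that[of 1] show thesis
    by (simp add: dual_cone_qi_def)
next
  case False
  have "compact (K \<inter> sphere 0 1)"
    by (simp add: assms(2) closed_Int_compact)
  moreover have "continuous_on (K \<inter> sphere 0 1) (\<lambda>v. l \<bullet> v)"
    by (intro continuous_intros)
  ultimately obtain u where u: "u \<in> K \<inter> sphere 0 1"
    and least: "\<And>v. v \<in> K \<inter> sphere 0 1 \<Longrightarrow> l \<bullet> u \<le> l \<bullet> v"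
    using continuous_attains_inf[OF _ False] by blast
  define m where "m = l \<bullet> u"
  have m: "m > 0"
    using u assms(3) by (auto simp: m_def dual_cone_qi_def)
  \<comment> \<open>Adding 1 covers \<open>q = 0\<close> and makes \<open>e * norm q < m\<close>
    strict.\<close>
  define e where "e = m / (norm q + 1)"
  have e: "e > 0"
    using m by (simp add: e_def add_nonneg_pos)
  have "e * norm q < e * (norm q + 1)"
    using e by simp
  also have "\<dots> = m"
    using norm_ge_zero[of q] by (simp add: e_def add_nonneg_eq_0_iff)
  finally have eq: "e * norm q < m" .
  have "(l + e *\<^sub>R q) \<bullet> v > 0" if v: "v \<in> K" "v \<noteq> 0" for v
  proof -
    define w where "w = (1 / norm v) *\<^sub>R v"
    have w: "w \<in> K \<inter> sphere 0 1"
      using v assms(1) by (simp add: w_def cone_def)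
    have "\<bar>q \<bullet> w\<bar> \<le> norm q"
      using Cauchy_Schwarz_ineq2[of q w] w by simp
    then have "e * (q \<bullet> w) \<ge> - (e * norm q)"
      using e mult_left_mono[of "- norm q" "q \<bullet> w" e] by simp
    then have "(l + e *\<^sub>R q) \<bullet> w > 0"
      using least[OF w] eq by (simp add: inner_add_left m_def)
    then show ?thesis
      using v by (simp add: w_def zero_less_divide_iff)
  qed
  then have "l + e *\<^sub>R q \<in> dual_cone_qi K"
    by (simp add: dual_cone_qi_def)
  with e that show thesis by blast
qed

lemma transpose_mult_mem_nonneg_orthant_iff:
  fixes M :: "real^'n^'k"
  shows "transpose M *v l \<in> nonneg_orthant \<longleftrightarrow> (\<forall>x\<in>nonneg_orthant. 0 \<le> l \<bullet> (M *v x))"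
proof -
  have inner: "l \<bullet> (M *v x) = (transpose M *v l) \<bullet> x" for x
    by (simp add: dot_lmul_matrix)
  show ?thesis
  proof
    assume "transpose M *v l \<in> nonneg_orthant"
    then show "\<forall>x\<in>nonneg_orthant. 0 \<le> l \<bullet> (M *v x)"
      unfolding inner by (auto simp: nonneg_orthant_def inner_vec_def intro!: sum_nonneg)
  next
    assume "\<forall>x\<in>nonneg_orthant. 0 \<le> l \<bullet> (M *v x)"
    then have "0 \<le> (transpose M *v l) \<bullet> axis i 1" for i
      using axis_mem_nonneg_orthant[of i] unfolding inner by blast
    then show "transpose M *v l \<in> nonneg_orthant"
      by (simp add: nonneg_orthant_def inner_axis)
  qed
qed

text \<open>The inequality constraint involves \<open>U\<close> only through
  \<open>transpose U *v l\<close>, so the argument can work with pairs of vectors in place of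
  matrices.\<close>

lemma mem_dual_feasible_iff:
  "(l, U, v) \<in> dual_feasible K L A \<longleftrightarrow> l \<in> dual_cone_qi K \<and> l \<bullet> v = 0 \<and>
    (\<forall>x\<in>nonneg_orthant. (transpose U *v l) \<bullet> (A *v x) \<le> l \<bullet> (L *v x))"
proof -
  have "l \<bullet> ((L - U ** A) *v x) = l \<bullet> (L *v x) - (transpose U *v l) \<bullet> (A *v x)" for x
    by (simp add: dot_lmul_matrix matrix_vector_mult_diff_rdistrib inner_diff_right
        flip: matrix_vector_mul_assoc)
  then show ?thesis
    by (simp add: dual_feasible_def transpose_mult_mem_nonneg_orthant_iff
        del: transpose_matrix_vector)
qed

lemma exists_matrix_transpose_mult_eq:
  fixes l :: "real^'k" and y :: "real^'m"
  assumes "l \<noteq> 0"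
  obtains U :: "real^'m^'k" where "transpose U *v l = y"
proof
  \<comment> \<open>The witness is the rank-one matrix
    \<open>l y^T / (l \<bullet> l)\<close>.\<close>
  have "transpose (\<chi> i j. l $ i * y $ j / (l \<bullet> l)) *v l = (\<chi> j. y $ j * (l \<bullet> l) / (l \<bullet> l))"
    unfolding vec_eq_iff
    by (auto simp: matrix_vector_mult_def transpose_def inner_vec_def sum_distrib_left
        sum_divide_distrib intro!: sum.cong)
  also have "\<dots> = y"
    using assms by (simp add: vec_eq_iff)
  finally show "transpose (\<chi> i j. l $ i * y $ j / (l \<bullet> l)) *v l = y" .
qed

lemma efficient_max_dual_bound:
  assumes "cone K" "K \<noteq> {0}"
    and eff: "efficient_max K (dual_objective b) (dual_feasible K L A) (lbar, Ubar, vbar)"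
    and l: "l \<in> dual_cone_qi K"
    and y: "\<And>x. x \<in> nonneg_orthant \<Longrightarrow> y \<bullet> (A *v x) \<le> l \<bullet> (L *v x)"
    and "K \<noteq> {}"
  shows "y \<bullet> b \<le> l \<bullet> (Ubar *v b + vbar)"
proof (rule ccontr)
  define d where "d = Ubar *v b + vbar"
  assume "\<not> y \<bullet> b \<le> l \<bullet> (Ubar *v b + vbar)"
  then have gap: "y \<bullet> b - l \<bullet> d > 0"
    by (simp add: d_def)
  obtain k where k: "k \<in> K" "k \<noteq> 0"
    using assms(2,6) by blast
  with l have lk: "l \<bullet> k > 0"
    by (simp add: dual_cone_qi_def)
  then have "l \<noteq> 0" by auto
  then obtain U :: "real^'b^'a" where U: "transpose U *v l = y"
    by (rule exists_matrix_transpose_mult_eq)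
  \<comment> \<open>This \<open>t\<close> solves
    \<open>l \<bullet> (d + t *\<^sub>R k) = y \<bullet> b\<close>. Hence the \<open>v\<close>
    below, which raises the objective value to \<open>d + t *\<^sub>R k\<close>, is orthogonal to
    \<open>l\<close>.\<close>
  define t where "t = (y \<bullet> b - l \<bullet> d) / (l \<bullet> k)"
  have t: "t > 0"
    using gap lk by (simp add: t_def)
  define v where "v = d + t *\<^sub>R k - U *v b"
  have "l \<bullet> (U *v b) = y \<bullet> b"
    by (simp add: dot_lmul_matrix flip: U)
  then have "l \<bullet> v = 0"
    using lk by (simp add: v_def t_def inner_diff_right inner_add_right)
  then have "(l, U, v) \<in> dual_feasible K L A"
    using l y U by (simp add: mem_dual_feasible_iff)
  moreover have "cone_leq K (dual_objective b (lbar, Ubar, vbar)) (dual_objective b (l, U, v))"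
    using t k assms(1)
    by (simp add: cone_leq_def cone_leqq_def dual_objective_def v_def cone_def flip: d_def)
  ultimately show False
    using eff by (auto simp: efficient_max_def)
qed

text \<open>A nonzero difference in \<open>K\<close> would have positive product with
  \<open>l\<close>, whereas feasibility gives
  \<open>l \<bullet> (U *v b + v) \<le> l \<bullet> (L *v x)\<close>.\<close>

lemma weak_duality:
  assumes feas: "(l, U, v) \<in> dual_feasible K L A" and x: "x \<in> primal_feasible A b"
  shows "\<not> cone_leq K (primal_objective L x) (U *v b + v)"
proof
  assume "cone_leq K (primal_objective L x) (U *v b + v)"
  then have "l \<bullet> (U *v b + v - L *v x) > 0"
    using feas by (auto simp: cone_leq_def cone_leqq_def primal_objective_def
        mem_dual_feasible_iff dual_cone_qi_def)
  moreover have "(transpose U *v l) \<bullet> b \<le> l \<bullet> (L *v x)" "l \<bullet> v = 0"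
    using feas x by (auto simp: mem_dual_feasible_iff primal_feasible_def)
  ultimately show False
    by (simp add: dot_lmul_matrix inner_diff_right inner_add_right)
qed

theorem theorem4:
  fixes K :: "(real ^ 'k) set"
    and L :: "real ^ 'n ^ 'k"
    and A :: "real ^ 'n ^ 'm"
    and b :: "real ^ 'm"
    and lbar :: "real ^ 'k"
    and Ubar :: "real ^ 'm ^ 'k"
    and vbar :: "real ^ 'k"
  assumes "cone K" and "convex K" and "closed K"
    and "nontrivial_cone K" and "pointed_cone K"
    and "efficient_max K (dual_objective b) (dual_feasible K L A) (lbar, Ubar, vbar)"
  shows "\<exists>xbar. xbar \<in> primal_feasible A b
      \<and> efficient_min K (primal_objective L) (primal_feasible A b) xbar
      \<and> L *v xbar = Ubar *v b + vbar"
proof -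
  define d where "d = Ubar *v b + vbar"
  define y where "y = transpose Ubar *v lbar"
  have K: "K \<noteq> {0}" "K \<noteq> {}"
    using assms(4,5) by (auto simp: nontrivial_cone_def pointed_cone_def)
  have feas: "(lbar, Ubar, vbar) \<in> dual_feasible K L A"
    using assms(6) by (simp add: efficient_max_def)
  then have lbar: "lbar \<in> dual_cone_qi K" and orth: "lbar \<bullet> vbar = 0"
    and y: "\<And>x. x \<in> nonneg_orthant \<Longrightarrow> y \<bullet> (A *v x) \<le> lbar \<bullet> (L *v x)"
    by (auto simp: mem_dual_feasible_iff y_def)
  have yb: "y \<bullet> b = lbar \<bullet> d"
    using orth by (simp add: y_def d_def dot_lmul_matrix inner_add_right)
  define f where "f = (\<lambda>x. (A *v x, L *v x))"
  have "linear f"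
    by (rule linearI) (simp_all add: f_def matrix_vector_right_distrib matrix_vector_mult_scaleR)
  have "(b, d) \<in> f ` nonneg_orthant"
  proof (rule ccontr)
    assume "(b, d) \<notin> f ` nonneg_orthant"
    with \<open>linear f\<close> obtain a where a: "a \<bullet> (b, d) < 0"
      "\<And>x. x \<in> nonneg_orthant \<Longrightarrow> 0 \<le> a \<bullet> f x"
      by (rule farkas) blast
    obtain p q where pq: "a = (p, q)" by (cases a)
    obtain e where e: "e > 0" and le: "lbar + e *\<^sub>R q \<in> dual_cone_qi K"
      using dual_cone_qi_perturb[OF assms(1,3) lbar] by blast
    \<comment> \<open>The separating functional adds its two parts, while the dual constraint has
      \<open>A *v x\<close> and \<open>L *v x\<close> on opposite sides; hence the minus sign at
      \<open>p\<close>.\<close>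
    have "(y - e *\<^sub>R p) \<bullet> (A *v x) \<le> (lbar + e *\<^sub>R q) \<bullet> (L *v x)" if x: "x \<in> nonneg_orthant" for x
    proof -
      have "0 \<le> e * (p \<bullet> (A *v x) + q \<bullet> (L *v x))"
        using a(2)[OF x] e by (simp add: pq f_def)
      with y[OF x] show ?thesis
        by (simp add: inner_diff_left inner_add_left distrib_left)
    qed
    then have "(y - e *\<^sub>R p) \<bullet> b \<le> (lbar + e *\<^sub>R q) \<bullet> d"
      unfolding d_def using efficient_max_dual_bound[OF assms(1) K(1) assms(6) le _ K(2)] by blast
    \<comment> \<open>The unperturbed terms cancel by \<open>yb\<close>, which leaves the sign
      opposite to \<open>a(1)\<close>.\<close>
    then have "0 \<le> e * (p \<bullet> b + q \<bullet> d)"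
      using yb by (simp add: inner_diff_left inner_add_left distrib_left)
    with a(1) e show False
      by (simp add: pq zero_le_mult_iff)
  qed
  then obtain x where x: "x \<in> nonneg_orthant" "A *v x = b" "L *v x = d"
    by (auto simp: f_def)
  then have "x \<in> primal_feasible A b"
    by (simp add: primal_feasible_def)
  moreover from this have "efficient_min K (primal_objective L) (primal_feasible A b) x"
    using weak_duality[OF feas] x(3)
    by (auto simp: efficient_min_def primal_objective_def[of L x] d_def)
  ultimately show ?thesis
    using x(3) d_def by blast
qed

end
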